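(* For every positive integer $\ell$ and every real $x$, and for either consistent choice of the sign $\pm$, $$\frac{d^{2\ell}e^{\pm x^2}}{dx^{2\ell}}=(\pm2)^{\ell}e^{\pm x^2}\sum_{k=0}^{\ell}\frac{(\pm2)^k}{[2(k+\ell)-1]!!}\,a_{2\ell+1,2k}\,x^{2k}$$ and $$\frac{d^{2\ell-1}e^{\pm x^2}}{dx^{2\ell-1}}=(\pm2)^{\ell}x\,e^{\pm x^2}\sum_{k=0}^{\ell-1}\frac{(\pm2)^k}{[2(k+\ell)-1]!!}\,a_{2\ell,2k+1}\,x^{2k}.$$
   Context: The numbers $a_{m,k}$ are defined by $a_{2p-1,0}=[(2p-3)!!]^2$, $a_{2p,1}=[(2p-1)!!]^2$, $a_{p+1,p}=(2p-1)!!$ for $p\ge1$, and $a_{m,k}=\dfrac{(m+k-2)!!\,(m-1)!}{2^{m-k-2}\,k!}$ for $m\ge k+2\ge3$. $n!!$ is the double factorial, with $(-1)!!=1$.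
   Formalization: In the general clause for a_{m,k} (m≥k+2≥3) the denominator 2^{m-k-2} k! is replaced by (m-k-1)!! k!, because the printed clauses conflict (a_{8,1}=11025 versus 16537.5) and the printed a_{9,2} makes the eighth-derivative identity false. *)

theory Defs
  imports "HOL-Analysis.Analysis"
begin

text \<open>
  Double factorial with an integer argument, so that \<open>(-1)!! = 1\<close> can be written as it stands.
  Only arguments at least \<open>-1\<close> are meant; smaller ones get the value 1.
\<close>

function dfact :: "int \<Rightarrow> nat" where
  "dfact n = (if n \<le> 0 then 1 else nat n * dfact (n - 2))"
  by auto
termination by (relation "Wellfounded.measure nat") auto

declare dfact.simps [simp del]

lemma dfact_neg1: "dfact (-1) = 1"
  by (simp add: dfact.simps)

text \<open>
  The coefficients \<open>a\<^sub>m\<^sub>,\<^sub>k\<close>. The source prints the denominator of the last case as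
  \<open>2 ^ (m - k - 2) * k!\<close>. That reading is inconsistent with its own clause
  \<open>a\<^sub>2\<^sub>p\<^sub>,\<^sub>1 = ((2p - 1)!!)\<^sup>2\<close>, which it contradicts at \<open>m = 8, k = 1\<close> (lemma
  \<open>printed_clauses_conflict\<close>), and it makes the formulas for the derivatives of
  \<open>exp (\<plusminus> x\<^sup>2)\<close> false from order 8 on. We use \<open>(m - k - 1)!! * k!\<close>, which has the same value
  for \<open>m - k = 2, 3, 5\<close> and agrees with the other clauses wherever they overlap.

  The source leaves all other pairs \<open>(m, k)\<close> undefined.
\<close>

definition acoef :: "nat \<Rightarrow> nat \<Rightarrow> real" where
  "acoef m k =
    (if k = 0 \<and> odd m then (real (dfact (int m - 2)))\<^sup>2
     else if k = 1 \<and> even m \<and> m \<ge> 2 then (real (dfact (int m - 1)))\<^sup>2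
     else if k \<ge> 1 \<and> m = k + 1 then real (dfact (2 * int k - 1))
     else if k \<ge> 1 \<and> m \<ge> k + 2 then
       real (dfact (int m + int k - 2)) * fact (m - 1) /
         (real (dfact (int m - int k - 1)) * fact k)
     else undefined)"

lemma printed_clauses_conflict:
  "real (dfact (8 + 1 - 2)) * fact (8 - 1) / (2 ^ (8 - 1 - 2) * fact 1)
     \<noteq> (real (dfact (2 * 4 - 1)))\<^sup>2"
  by (simp add: dfact.simps fact_numeral)

lemma fact_dfact: "fact n = dfact (int n) * dfact (int n - 1)"
proof (induction n)
  case (Suc n)
  then show ?case
    by (simp add: dfact.simps [of "1 + int n"] nat_add_distrib algebra_simps)
qed (simp add: dfact.simps)

lemma acoef_odd_0:
  assumes "p \<ge> 1"
  shows "acoef (2 * p - 1) 0 = (real (dfact (2 * int p - 3)))\<^sup>2"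
  using assms by (simp add: acoef_def of_nat_diff)

lemma acoef_even_1:
  assumes "p \<ge> 1"
  shows "acoef (2 * p) 1 = (real (dfact (2 * int p - 1)))\<^sup>2"
  using assms by (simp add: acoef_def)

lemma acoef_Suc:
  assumes "p \<ge> 1"
  shows "acoef (p + 1) p = real (dfact (2 * int p - 1))"
  using assms by (cases "p = 1") (auto simp: acoef_def dfact.simps)

lemma dfact_nonzero: "dfact n \<noteq> 0"
  by (induction n rule: dfact.induct) (subst dfact.simps, auto)

lemma acoef_general:
  assumes "m \<ge> k + 2" "k + 2 \<ge> 3"
  shows "acoef m k =
    real (dfact (int m + int k - 2)) * fact (m - 1) /
      (real (dfact (int m - int k - 1)) * fact k)"
proof (cases "k = 1 \<and> even m")
  case True
  have "fact (m - 1) = real (dfact (int m - 1)) * real (dfact (int m - 2))"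
  proof -
    have "real (fact (m - 1)) = real (dfact (int (m - 1)) * dfact (int (m - 1) - 1))"
      using fact_dfact[of "m - 1"] by (metis of_nat_fact of_nat_id)
    then show ?thesis using assms by (simp add: of_nat_diff)
  qed
  then show ?thesis
    using True assms dfact_nonzero[of "int m - 2"] by (simp add: acoef_def power2_eq_square)
next
  case False
  then show ?thesis using assms by (auto simp: acoef_def)
qed

end

theory Submission
  imports Defs
begin

text \<open>
  For fixed \<open>x\<close> the factorisation
  \<open>exp (s * (x + h)\<^sup>2) = exp (s * x\<^sup>2) * exp (2 * s * x * h) * exp (s * h\<^sup>2)\<close>
  turns the Taylor series of \<open>exp (s * t\<^sup>2)\<close> at \<open>x\<close> into the Cauchy product of two exponential
  series in \<open>h\<close>. Its \<open>n\<close>-th coefficient times \<open>n!\<close> is the \<open>n\<close>-th derivative at \<open>x\<close>. The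
  factor \<open>exp (s * h\<^sup>2)\<close> has only even powers of \<open>h\<close>, so only powers of \<open>x\<close> with the parity of
  \<open>n\<close> survive; this gives \<open>higher_deriv_exp_square\<close>, an explicit Hermite-type sum in which
  factorials replace the \<open>a\<^sub>m\<^sub>,\<^sub>k\<close>.

  What remains is to recognise the coefficients. The case distinction that defines
  \<open>a\<^sub>m\<^sub>,\<^sub>k\<close> hides a single closed form: dividing by \<open>(m + k - 2)!!\<close> leaves
  \<open>(m - 1)! / ((m - k - 1)!! * k!)\<close> in every case that occurs, and \<open>m - k - 1\<close> is then even,
  so that its double factorial is a power of two times a factorial
  (\<open>acoef_div_dfact\<close>). The even and the odd orders of differentiation are treated together by
  writing the order as \<open>2 * m + r\<close> with \<open>r \<le> 1\<close>.
\<close>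

section \<open>Taylor coefficients and higher derivatives\<close>

text \<open>
  Term-by-term differentiation shifts the coefficients, and the constant coefficient is the value
  at \<open>0\<close>. This argument is valid over every Banach field, in particular over the reals.
\<close>

lemma higher_deriv_eq_fps_nth:
  fixes f :: "'a :: {banach, real_normed_field} \<Rightarrow> 'a"
  assumes "f has_fps_expansion F"
  shows "(deriv ^^ n) f 0 = fact n * fps_nth F n"
  using assms
proof (induction n arbitrary: f F)
  case 0
  then show ?case
    by (auto simp: has_fps_expansion_def eval_fps_at_0 dest: eventually_nhds_x_imp_x)
next
  case (Suc n)
  have "(deriv ^^ Suc n) f 0 = (deriv ^^ n) (deriv f) 0"
    by (simp add: funpow_Suc_right del: funpow.simps)
  also have "\<dots> = fact n * fps_nth (fps_deriv F) n"
    by (rule Suc.IH) (rule has_fps_expansion_deriv[OF Suc.prems])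
  finally show ?case
    by (simp add: algebra_simps)
qed

definition fps_exp_square :: "real \<Rightarrow> real fps" where
  "fps_exp_square s = Abs_fps (\<lambda>n. if even n then s ^ (n div 2) / fact (n div 2) else 0)"

lemma has_fps_expansion_exp_square:
  "(\<lambda>h. exp (s * h\<^sup>2)) has_fps_expansion fps_exp_square s"
proof (rule has_fps_expansionI, rule always_eventually, rule allI)
  fix u :: real
  have "(\<lambda>n. fps_nth (fps_exp_square s) (2 * n) * u ^ (2 * n)) sums exp (s * u\<^sup>2)"
    unfolding power_mult[of u 2] using exp_converges[of "s * u\<^sup>2"]
    by (simp add: fps_exp_square_def power_mult_distrib divide_inverse mult_ac)
  moreover have "strict_mono (\<lambda>n::nat. 2 * n)"
    by (auto intro: strict_monoI)
  moreover have "fps_nth (fps_exp_square s) n * u ^ n = 0" if "n \<notin> range (\<lambda>n. 2 * n)" for n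
    using that by (auto simp: fps_exp_square_def elim!: evenE)
  ultimately show "(\<lambda>n. fps_nth (fps_exp_square s) n * u ^ n) sums exp (s * u\<^sup>2)"
    using sums_mono_reindex[of "\<lambda>n. 2 * n" "\<lambda>n. fps_nth (fps_exp_square s) n * u ^ n"] by auto
qed

lemma sum_restrict_parity:
  fixes f :: "nat \<Rightarrow> 'a :: comm_monoid_add"
  assumes "r \<le> 1" and "\<And>i. odd (i + r) \<Longrightarrow> f i = 0"
  shows "(\<Sum>i=0..2 * m + r. f i) = (\<Sum>k=0..m. f (2 * k + r))"
proof -
  have "(\<Sum>i=0..2 * m + r. f i) = (\<Sum>i\<in>(\<lambda>k. 2 * k + r) ` {0..m}. f i)"
  proof (rule sum.mono_neutral_right; safe?)
    fix i assume i: "i \<in> {0..2 * m + r}" "i \<notin> (\<lambda>k. 2 * k + r) ` {0..m}"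
    have "odd (i + r)"
    proof
      assume "even (i + r)"
      moreover have "i \<le> 2 * m + r"
        using i(1) by simp
      ultimately have "\<exists>k\<le>m. i = 2 * k + r"
        using \<open>r \<le> 1\<close> by presburger
      with i(2) show False
        by auto
    qed
    then show "f i = 0"
      by (rule assms(2))
  qed auto
  also have "\<dots> = (\<Sum>k=0..m. f (2 * k + r))"
    by (subst sum.reindex) (auto simp: inj_on_def)
  finally show ?thesis .
qed

text \<open>
  For \<open>s = -1\<close> the sum is, up to sign, the Hermite polynomial of degree \<open>2 * m + r\<close>. The
  \<open>k\<close>-th term takes \<open>2 * k + r\<close> factors from \<open>exp (2 * s * x * h)\<close> and \<open>m - k\<close> factors from
  \<open>exp (s * h\<^sup>2)\<close>.
\<close>

lemma higher_deriv_exp_square: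
  fixes s x :: real
  assumes "r \<le> 1"
  shows "(deriv ^^ (2 * m + r)) (\<lambda>t. exp (s * t\<^sup>2)) x =
    exp (s * x\<^sup>2) * (\<Sum>k=0..m. fact (2 * m + r) * (2 * s * x) ^ (2 * k + r) * s ^ (m - k) /
      (fact (2 * k + r) * fact (m - k)))"
proof -
  define n where "n = 2 * m + r"
  define F where "F = fps_const (exp (s * x\<^sup>2)) * (fps_exp (2 * s * x) * fps_exp_square s)"
  have "(\<lambda>h. exp (s * x\<^sup>2) * (exp (2 * s * x * h) * exp (s * h\<^sup>2))) has_fps_expansion F"
    unfolding F_def by (intro fps_expansion_intros has_fps_expansion_exp_square)
  also have "(\<lambda>h. exp (s * x\<^sup>2) * (exp (2 * s * x * h) * exp (s * h\<^sup>2))) =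
      (\<lambda>t. exp (s * t\<^sup>2)) \<circ> (\<lambda>h. x + h)"
    by (auto simp: fun_eq_iff power2_sum algebra_simps simp flip: exp_add)
  finally have "(deriv ^^ n) (\<lambda>t. exp (s * t\<^sup>2)) x = fact n * fps_nth F n"
    by (subst higher_deriv_shift_0) (rule higher_deriv_eq_fps_nth)
  also have "fps_nth F n = exp (s * x\<^sup>2) *
      (\<Sum>i=0..n. (2 * s * x) ^ i / fact i * fps_nth (fps_exp_square s) (n - i))"
    by (simp add: F_def fps_mult_nth[of "fps_exp _"])
  also have "(\<Sum>i=0..n. (2 * s * x) ^ i / fact i * fps_nth (fps_exp_square s) (n - i)) =
      (\<Sum>i=0..n. if odd (i + r) then 0
        else (2 * s * x) ^ i / fact i * fps_nth (fps_exp_square s) (n - i))"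
    by (rule sum.cong) (auto simp: fps_exp_square_def n_def)
  also have "\<dots> = (\<Sum>k=0..m. (2 * s * x) ^ (2 * k + r) / fact (2 * k + r) *
      (s ^ (m - k) / fact (m - k)))"
  proof -
    have "n - (2 * k + r) = 2 * (m - k)" for k
      by (auto simp: n_def)
    then show ?thesis
      unfolding n_def by (subst sum_restrict_parity[OF assms]) (auto simp: fps_exp_square_def)
  qed
  finally show ?thesis
    by (simp add: n_def sum_distrib_left field_simps)
qed

section \<open>A closed form for the coefficients\<close>

lemma dfact_even: "dfact (2 * int j) = 2 ^ j * fact j"
proof (induction j)
  case (Suc j)
  have "dfact (2 * int (Suc j)) = nat (2 * int (Suc j)) * dfact (2 * int j)"
    by (subst dfact.simps) (simp add: algebra_simps)
  with Suc show ?case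
    by (simp add: nat_add_distrib nat_mult_distrib algebra_simps)
qed (simp add: dfact.simps)

lemma dfact_odd:
  assumes "r \<le> 1"
  shows "real (dfact (2 * int (m + r) - 1)) = fact (2 * m + r) / (2 ^ m * fact m)"
proof -
  have "fact (2 * m + r) = dfact (2 * int m) * dfact (2 * int (m + r) - 1)"
    using assms fact_dfact[of "2 * m + r"] by (auto simp: le_Suc_eq algebra_simps)
  then have "real (fact (2 * m + r)) = real (2 ^ m * fact m * dfact (2 * int (m + r) - 1))"
    by (simp only: dfact_even)
  then show ?thesis
    by (simp add: field_simps)
qed

text \<open>
  With \<open>M = 2 * m + r + 1\<close> and \<open>K = 2 * k + r\<close> the right-hand side is
  \<open>(M - 1)! / ((M - K - 1)!! * K!)\<close>. For \<open>k = 0\<close> the coefficient is a square;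
  one factor cancels against the denominator, and \<open>dfact_odd\<close> evaluates the other. For
  \<open>k \<ge> 1\<close> both sides are \<open>1\<close> on the diagonal \<open>M = K + 1\<close>, and off it the formula is
  \<open>acoef_general\<close>.
\<close>

lemma acoef_div_dfact:
  assumes "r \<le> 1" and "k \<le> m"
  shows "acoef (2 * m + r + 1) (2 * k + r) / real (dfact (2 * int (k + m + r) - 1)) =
    fact (2 * m + r) / (2 ^ (m - k) * fact (m - k) * fact (2 * k + r))"
proof -
  consider "k = 0" | "k \<ge> 1" "k = m" | "k \<ge> 1" "k < m"
    using assms by linarith
  then show ?thesis
  proof cases
    case 1
    have "r = 0 \<or> r = 1"
      using assms by linarith
    then have "acoef (2 * m + r + 1) r = (real (dfact (2 * int (m + r) - 1)))\<^sup>2"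
      using acoef_odd_0[of "m + 1"] acoef_even_1[of "m + 1"] by (elim disjE) simp_all
    moreover have "(fact r :: real) = 1"
      using \<open>r = 0 \<or> r = 1\<close> by auto
    ultimately show ?thesis
      using 1 dfact_odd[OF \<open>r \<le> 1\<close>, of m] dfact_nonzero[of "2 * int (m + r) - 1"]
      by (simp add: power2_eq_square)
  next
    case 2
    have "acoef (2 * m + r + 1) (2 * m + r) = real (dfact (2 * int (m + m + r) - 1))"
      using acoef_Suc[of "2 * m + r"] 2 by (simp add: algebra_simps)
    with 2 dfact_nonzero[of "2 * int (m + m + r) - 1"] show ?thesis
      by simp
  next
    case 3
    have "acoef (2 * m + r + 1) (2 * k + r) =
        real (dfact (2 * int (k + m + r) - 1)) * fact (2 * m + r) /
          (real (dfact (2 * int (m - k))) * fact (2 * k + r))"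
      using 3 by (subst acoef_general) (auto simp: of_nat_diff algebra_simps)
    then show ?thesis
      unfolding dfact_even using dfact_nonzero[of "2 * int (k + m + r) - 1"] by simp
  qed
qed

text \<open>
  The powers of two balance because \<open>(m + r) + k = (m - k) + (2 * k + r)\<close>: the part
  \<open>2 ^ (m - k)\<close> is absorbed by the double factorial inside the coefficient, and
  \<open>2 ^ (2 * k + r)\<close> belongs to \<open>(2 * s * x) ^ (2 * k + r)\<close>.
\<close>

lemma higher_deriv_exp_square_acoef:
  fixes s x :: real
  assumes "r \<le> 1"
  shows "(deriv ^^ (2 * m + r)) (\<lambda>t. exp (s * t\<^sup>2)) x =
    (s * 2) ^ (m + r) * x ^ r * exp (s * x\<^sup>2) *
      (\<Sum>k=0..m. (s * 2) ^ k / real (dfact (2 * int (k + m + r) - 1)) *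
        acoef (2 * m + r + 1) (2 * k + r) * x ^ (2 * k))"
proof -
  have "fact (2 * m + r) * (2 * s * x) ^ (2 * k + r) * s ^ (m - k) /
        (fact (2 * k + r) * fact (m - k)) =
      (s * 2) ^ (m + r) * x ^ r * ((s * 2) ^ k / real (dfact (2 * int (k + m + r) - 1)) *
        acoef (2 * m + r + 1) (2 * k + r) * x ^ (2 * k))"
    if "k \<le> m" for k
  proof -
    define j where "j = m - k"
    then have m: "m = j + k"
      using that by simp
    have "(s * 2) ^ k / real (dfact (2 * int (k + m + r) - 1)) *
        acoef (2 * m + r + 1) (2 * k + r) * x ^ (2 * k) =
      (s * 2) ^ k * (acoef (2 * m + r + 1) (2 * k + r) / real (dfact (2 * int (k + m + r) - 1))) *
        x ^ (2 * k)"
      by simp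
    also have "\<dots> = (s * 2) ^ k * (fact (2 * m + r) /
        (2 ^ (m - k) * fact (m - k) * fact (2 * k + r))) * x ^ (2 * k)"
      unfolding acoef_div_dfact[OF assms that] ..
    also have "(s * 2) ^ (m + r) * x ^ r * \<dots> =
        (s * 2) ^ (m + r) * x ^ r * (s * 2) ^ k * fact (2 * m + r) * x ^ (2 * k) /
          (2 ^ j * fact j * fact (2 * k + r))"
      by (simp add: j_def)
    also have "(s * 2) ^ (m + r) * x ^ r * (s * 2) ^ k * fact (2 * m + r) * x ^ (2 * k) =
        2 ^ j * (fact (2 * m + r) * (2 * s * x) ^ (2 * k + r) * s ^ j)"
    proof -
      have "(s * 2) ^ (m + r) * (s * 2) ^ k = (s * 2) ^ (j + (2 * k + r))"
        by (simp only: m power_add[symmetric] mult_2 add_ac)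
      also have "\<dots> = 2 ^ j * s ^ j * (2 * s) ^ (2 * k + r)"
        by (simp only: power_add power_mult_distrib mult_ac)
      finally have "(s * 2) ^ (m + r) * (s * 2) ^ k * (x ^ r * x ^ (2 * k) * fact (2 * m + r)) =
          2 ^ j * s ^ j * (2 * s) ^ (2 * k + r) * (x ^ r * x ^ (2 * k) * fact (2 * m + r))"
        by simp
      then show ?thesis
        unfolding power_mult_distrib[of "2 * s" x] power_add[of x] by (simp only: mult_ac)
    qed
    finally show ?thesis
      by (simp add: j_def mult_ac)
  qed
  then show ?thesis
    unfolding higher_deriv_exp_square[OF assms] sum_distrib_left
    by (intro sum.cong) (auto simp: mult_ac)
qed

theorem theorem4p2:
  fixes l :: nat and x s :: real
  assumes "l \<ge> 1" and "s = 1 \<or> s = -1"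
  shows "(deriv ^^ (2 * l)) (\<lambda>t. exp (s * t\<^sup>2)) x =
      (s * 2) ^ l * exp (s * x\<^sup>2) *
        (\<Sum>k=0..l. (s * 2) ^ k / real (dfact (2 * (int k + int l) - 1)) *
          acoef (2 * l + 1) (2 * k) * x ^ (2 * k))
    \<and> (deriv ^^ (2 * l - 1)) (\<lambda>t. exp (s * t\<^sup>2)) x =
      (s * 2) ^ l * x * exp (s * x\<^sup>2) *
        (\<Sum>k=0..l - 1. (s * 2) ^ k / real (dfact (2 * (int k + int l) - 1)) *
          acoef (2 * l) (2 * k + 1) * x ^ (2 * k))"
proof
  show "(deriv ^^ (2 * l)) (\<lambda>t. exp (s * t\<^sup>2)) x =
      (s * 2) ^ l * exp (s * x\<^sup>2) *
        (\<Sum>k=0..l. (s * 2) ^ k / real (dfact (2 * (int k + int l) - 1)) *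
          acoef (2 * l + 1) (2 * k) * x ^ (2 * k))"
    using higher_deriv_exp_square_acoef[of 0 l s x] by simp
next
  obtain m where l: "l = m + 1"
    using assms(1) by (metis le_add_diff_inverse2)
  have "2 * (m + 1) - 1 = 2 * m + 1" "2 * (m + 1) = 2 * m + 1 + 1" "m + 1 - 1 = m"
    "\<And>k. 2 * (int k + int (m + 1)) - 1 = 2 * int (k + m + 1) - 1"
    by simp_all
  then show "(deriv ^^ (2 * l - 1)) (\<lambda>t. exp (s * t\<^sup>2)) x =
      (s * 2) ^ l * x * exp (s * x\<^sup>2) *
        (\<Sum>k=0..l - 1. (s * 2) ^ k / real (dfact (2 * (int k + int l) - 1)) *
          acoef (2 * l) (2 * k + 1) * x ^ (2 * k))"
    using higher_deriv_exp_square_acoef[of 1 m s x] unfolding l by (simp only: power_one_right le_refl)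
qed

end
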